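(* Let $0<\alpha<1$ and $\beta>1$. Then the function $$\Phi_{\alpha,\beta}(s)=\frac{s^\alpha}{\bigl(1+(1-\alpha)s^{\alpha-1}\bigr)^\beta},\qquad s>0,$$ does not belong to $\mathcal{BF}$.
   Context: $\mathcal{CM}$ is the class of completely monotone functions: $g\in C^\infty(0,\infty)$ with $(-1)^n g^{(n)}(s)\ge 0$ for all integers $n\ge 0$ and all $s>0$. $\mathcal{BF}$ is the class of Bernstein functions: $f\in C^\infty(0,\infty)$ with $f(s)\ge 0$ for all $s>0$ and $f'\in\mathcal{CM}$. *)

theory Defs
  imports "HOL-Analysis.Analysis"
begin

text \<open>
  The functions of the paper live on the half-line \<open>{0<..}\<close>; here they are total functions on the
  reals. Every condition below is imposed only at points \<open>s > 0\<close>, and since \<open>{0<..}\<close> is open,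
  the iterated derivatives at such points do not depend on the values of the function at
  arguments \<open>\<le> 0\<close>.
\<close>

text \<open>
  \<open>deriv\<close> is a total operator with an unspecified value where no derivative exists, so existence
  of the derivatives of all orders is demanded explicitly (continuity of each of them follows).
\<close>

definition smooth_pos :: "(real \<Rightarrow> real) set" where
  "smooth_pos = {g. \<forall>n. \<forall>s>0. (deriv ^^ n) g differentiable (at s)}"

definition completely_monotone :: "(real \<Rightarrow> real) set" where
  "completely_monotone = {g. g \<in> smooth_pos \<and> (\<forall>n. \<forall>s>0. (-1) ^ n * (deriv ^^ n) g s \<ge> 0)}"

definition bernstein_functions :: "(real \<Rightarrow> real) set" where
  "bernstein_functions =
     {f. f \<in> smooth_pos \<and> (\<forall>s>0. f s \<ge> 0) \<and> deriv f \<in> completely_monotone}"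

definition Phi :: "real \<Rightarrow> real \<Rightarrow> real \<Rightarrow> real" where
  "Phi \<alpha> \<beta> s = s powr \<alpha> / (1 + (1 - \<alpha>) * s powr (\<alpha> - 1)) powr \<beta>"

end

theory Submission
  imports Defs
begin

text \<open>
  A Bernstein function \<open>f\<close> is nonnegative and concave, so \<open>f x / x\<close> stays bounded away from
  \<open>0\<close> as \<open>x \<rightarrow> 0\<close> unless \<open>f 1 = 0\<close>. But \<open>Phi \<alpha> \<beta> x\<close> is of order \<open>x powr (\<alpha> + \<beta> * (1 - \<alpha>))\<close>
  near \<open>0\<close>, and this exponent exceeds \<open>1\<close> when \<open>\<beta> > 1\<close>.
\<close>

lemma bernstein_concave:
  assumes "f \<in> bernstein_functions"
  shows "concave_on {0<..} f"
proof (rule f''_le0_imp_concave)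
  fix x :: real
  assume x: "x \<in> {0<..}"
  have "f \<in> smooth_pos" and cm: "deriv f \<in> completely_monotone"
    using assms by (auto simp: bernstein_functions_def)
  then have d: "(deriv ^^ n) f differentiable (at x)" for n
    using x by (auto simp: smooth_pos_def)
  show "(f has_real_derivative deriv f x) (at x)"
    using d[of 0] by (simp add: DERIV_deriv_iff_real_differentiable)
  show "(deriv f has_real_derivative deriv (deriv f) x) (at x)"
    using d[of 1] by (simp add: DERIV_deriv_iff_real_differentiable)
  have "(-1) ^ 1 * (deriv ^^ 1) (deriv f) x \<ge> 0"
    using cm x unfolding completely_monotone_def by blast
  then show "deriv (deriv f) x \<le> 0"
    by simp
qed simp

text \<open>Concavity is known only on the open half-line, and \<open>f 0\<close> is arbitrary, so
  the chord cannot start at 0. It runs from \<open>x / 2\<close> to 1 instead, and the nonnegative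
  term at \<open>x / 2\<close> is dropped; this costs the factor 1/2.\<close>

lemma bernstein_linear_lower_bound:
  assumes "f \<in> bernstein_functions" and x: "0 < x" "x < 1"
  shows "x / 2 * f 1 \<le> f x"
proof -
  have nonneg: "0 \<le> f s" if "s > 0" for s
    using assms(1) that by (auto simp: bernstein_functions_def)
  \<comment> \<open>The weight solves \<open>(1 - t) * (x / 2) + t = x\<close>; its denominator is
    below 1, whence \<open>x / 2 \<le> t\<close>.\<close>
  define t where "t = (x / 2) / (1 - x / 2)"
  have t: "x / 2 \<le> t" "0 \<le> t" "t \<le> 1"
    using x by (auto simp: t_def field_simps)
  have "t * (1 - x / 2) = x / 2"
    using x unfolding t_def by (intro nonzero_eq_divide_eq[THEN iffD1]) auto
  then have x_eq: "(1 - t) * (x / 2) + t * 1 = x"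
    by (simp add: field_simps)
  have "(1 - t) * f (x / 2) + t * f 1 \<le> f ((1 - t) * (x / 2) + t * 1)"
    using concave_onD[OF bernstein_concave[OF assms(1)], of t "x / 2" 1] x t by simp
  moreover have "0 \<le> (1 - t) * f (x / 2)"
    using nonneg[of "x / 2"] t x by simp
  moreover have "x / 2 * f 1 \<le> t * f 1"
    using nonneg[of 1] t by (intro mult_right_mono) auto
  ultimately show ?thesis
    unfolding x_eq by linarith
qed

text \<open>Discarding the summand 1 in the base of the denominator leaves a pure power of
  \<open>x\<close>. One factor \<open>x\<close> is split off to match the linear lower
  bound.\<close>

lemma Phi_upper_bound:
  assumes "\<alpha> < 1" "0 \<le> \<beta>" "0 < x"
  shows "Phi \<alpha> \<beta> x \<le> x * (x powr ((1 - \<alpha>) * (\<beta> - 1)) / (1 - \<alpha>) powr \<beta>)"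
proof -
  have "((1 - \<alpha>) * x powr (\<alpha> - 1)) powr \<beta> \<le> (1 + (1 - \<alpha>) * x powr (\<alpha> - 1)) powr \<beta>"
    using assms by (intro powr_mono2) auto
  then have "Phi \<alpha> \<beta> x \<le> x powr \<alpha> / ((1 - \<alpha>) * x powr (\<alpha> - 1)) powr \<beta>"
    unfolding Phi_def using assms by (intro divide_left_mono mult_pos_pos) auto
  also have "\<dots> = x powr (\<alpha> - (\<alpha> - 1) * \<beta>) / (1 - \<alpha>) powr \<beta>"
    using assms by (simp only: powr_mult powr_powr powr_diff[of x \<alpha> "(\<alpha> - 1) * \<beta>"]) simp
  also have "\<alpha> - (\<alpha> - 1) * \<beta> = 1 + (1 - \<alpha>) * (\<beta> - 1)"
    by (simp add: algebra_simps)
  also have "x powr (1 + (1 - \<alpha>) * (\<beta> - 1)) = x * x powr ((1 - \<alpha>) * (\<beta> - 1))"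
    using assms by (simp add: powr_add)
  finally show ?thesis by simp
qed

theorem proposition3p7:
  fixes \<alpha> \<beta> :: real
  assumes "0 < \<alpha>" and "\<alpha> < 1" and "\<beta> > 1"
  shows "Phi \<alpha> \<beta> \<notin> bernstein_functions"
proof
  assume bf: "Phi \<alpha> \<beta> \<in> bernstein_functions"
  define \<gamma> where "\<gamma> = (1 - \<alpha>) * (\<beta> - 1)"
  define c where "c = (1 - \<alpha>) powr \<beta>"
  have pos: "\<gamma> > 0" "c > 0"
    using assms by (auto simp: \<gamma>_def c_def)
  \<comment> \<open>Both bounds carry a factor \<open>x\<close>; cancelling it leaves a left side
    independent of \<open>x\<close>.\<close>
  have lower: "Phi \<alpha> \<beta> 1 / 2 \<le> x powr \<gamma> / c" if "0 < x" "x < 1" for x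
  proof -
    have "x * (Phi \<alpha> \<beta> 1 / 2) \<le> x * (x powr \<gamma> / c)"
      using bernstein_linear_lower_bound[OF bf that] Phi_upper_bound[of \<alpha> \<beta> x] assms that
      unfolding \<gamma>_def c_def by linarith
    then show ?thesis
      using that by (simp only: mult_le_cancel_left_pos)
  qed
  \<comment> \<open>The base tends to 0, so convergence rests on \<open>\<gamma> > 0\<close>, that
    is, on \<beta> > 1 and \<alpha> < 1. The value \<open>0 powr \<gamma>\<close> is 0.\<close>
  have "((\<lambda>x. x powr \<gamma>) \<longlongrightarrow> 0 powr \<gamma>) (at_right 0)"
    using pos by (intro tendsto_powr2) (auto simp: eventually_at_filter)
  then have "((\<lambda>x. x powr \<gamma> / c) \<longlongrightarrow> 0) (at_right 0)"
    using tendsto_divide[OF _ tendsto_const[of c]] pos by fastforce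
  moreover have "\<forall>\<^sub>F x in at_right 0. Phi \<alpha> \<beta> 1 / 2 \<le> x powr \<gamma> / c"
    using lower by (auto simp: eventually_at_right[of 0 1] intro!: exI[of _ 1])
  ultimately have "Phi \<alpha> \<beta> 1 / 2 \<le> 0"
    by (intro tendsto_lowerbound) auto
  moreover have "Phi \<alpha> \<beta> 1 > 0"
    using assms by (simp add: Phi_def)
  ultimately show False
    by linarith
qed

end
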